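(* For any degree $m\ge2$, the integral quasi-interpolants $G_2$ of degree $m$ are uniformly bounded independently of the partition of $I=[a,b]$. For $m=2k$ or $m=2k+1$ there holds $$\Vert G_2\Vert_\infty\le 2k+3 .$$
   Context: $I=[a,b]$ is a bounded interval with knots $t_{-m}=\cdots=t_0=a<t_1<\cdots<t_{n-1}<b=t_n=\cdots=t_{n+m}$. For $0\le j\le n+m-1$, $B_j$ is the B-spline of degree $m$ with knots $t_{j-m},\ldots,t_{j+1}$, normalized so that $\sum_jB_j=1$ on $I$. For $1\le i\le n+m-2$, $M_i$ is the B-spline of degree $m-2$ with knots $t_{i-m+1},\ldots,t_i$ (support $[t_{i-m+1},t_i]$), normalized by $\int M_i=1$, and $\lambda_i(f)=\int_a^bM_i(t)f(t)\,dt$. For the two degenerate indices, whose knots all coincide, $\lambda_0(f)=f(a)$ and $\lambda_{n+m-1}(f)=f(b)$. For $0\le i\le n+m-1$ set $$\theta_i=\frac1m\sum_{r=1}^m t_{i+1-r},\quad \theta_i^{(2)}=\frac{2}{m(m-1)}\sum_{1\le r<s\le m}t_{i+1-r}t_{i+1-s},\quad \mu_i^{(2)}=\frac{2}{m(m+1)}\sum_{1\le r\le s\le m}t_{i+1-r}t_{i+1-s}$$ ($\theta_i$ and $\mu_i^{(2)}$ are the first and second moments of $M_i$). The operator is $$G_2f=f(t_0)B_0+\sum_{i=1}^{n+m-2}\big[a_i\lambda_{i-1}(f)+b_i\lambda_i(f)+c_i\lambda_{i+1}(f)\big]B_i+f(t_n)B_{n+m-1},$$ where, for each $1\le i\le n+m-2$,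 $(a_i,b_i,c_i)$ is the solution of the linear system $$a_i+b_i+c_i=1,\quad \theta_{i-1}a_i+\theta_ib_i+\theta_{i+1}c_i=\theta_i,\quad \mu_{i-1}^{(2)}a_i+\mu_i^{(2)}b_i+\mu_{i+1}^{(2)}c_i=\theta_i^{(2)}$$ (which expresses that $G_2$ reproduces polynomials of degree at most $2$). $\Vert G_2\Vert_\infty$ is the operator norm on $C([a,b])$ with the sup norm. *)

theory Defs
  imports "HOL-Analysis.Analysis"
begin

text \<open>
  The knots are given by a function on the integers; only its values on
  \<open>{-m..n+m}\<close> matter, the endpoint knots having multiplicity \<open>m + 1\<close>.
\<close>

definition knot_sequence :: "nat \<Rightarrow> nat \<Rightarrow> real \<Rightarrow> real \<Rightarrow> (int \<Rightarrow> real) \<Rightarrow> bool" where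
  "knot_sequence m n a b t \<longleftrightarrow>
     1 \<le> n \<and>
     (\<forall>i\<in>{- int m..0}. t i = a) \<and>
     (\<forall>i\<in>{0..<int n}. t i < t (i + 1)) \<and>
     (\<forall>i\<in>{int n..int n + int m}. t i = b)"

text \<open>
  Cox--de Boor recursion: \<open>bspline t e d j\<close> is the B-spline of degree \<open>d\<close> with knots
  \<open>t j, \<dots>, t (j + d + 1)\<close>, in the normalization that forms a partition of unity. Quotients with
  a vanishing denominator are 0, which is the usual convention at coinciding knots.
  The knot intervals are half-open except that the last nondegenerate one is closed at the right
  end \<open>e\<close> of the spline interval, so that the partition of unity also holds at \<open>e\<close>.
\<close>

fun bspline :: "(int \<Rightarrow> real) \<Rightarrow> real \<Rightarrow> nat \<Rightarrow> int \<Rightarrow> real \<Rightarrow> real" where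
  "bspline t e 0 j x =
     (if t j \<le> x \<and> x < t (j + 1) \<or> t j < x \<and> x = t (j + 1) \<and> x = e then 1 else 0)"
| "bspline t e (Suc d) j x =
     (x - t j) / (t (j + int d + 1) - t j) * bspline t e d j x
   + (t (j + int d + 2) - x) / (t (j + int d + 2) - t (j + 1)) * bspline t e d (j + 1) x"

definition B :: "nat \<Rightarrow> nat \<Rightarrow> (int \<Rightarrow> real) \<Rightarrow> int \<Rightarrow> real \<Rightarrow> real" where
  "B m n t j = bspline t (t (int n)) m (j - int m)"

definition M :: "nat \<Rightarrow> nat \<Rightarrow> (int \<Rightarrow> real) \<Rightarrow> int \<Rightarrow> real \<Rightarrow> real" where
  "M m n t i x =
     bspline t (t (int n)) (m - 2) (i - int m + 1) x
     / integral {t 0..t (int n)} (bspline t (t (int n)) (m - 2) (i - int m + 1))"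

definition lam :: "nat \<Rightarrow> nat \<Rightarrow> (int \<Rightarrow> real) \<Rightarrow> int \<Rightarrow> (real \<Rightarrow> real) \<Rightarrow> real" where
  "lam m n t i f =
     (if i = 0 then f (t 0)
      else if i = int n + int m - 1 then f (t (int n))
      else integral {t 0..t (int n)} (\<lambda>x. M m n t i x * f x))"

definition theta :: "nat \<Rightarrow> (int \<Rightarrow> real) \<Rightarrow> int \<Rightarrow> real" where
  "theta m t i = 1 / real m * (\<Sum>r\<in>{1..int m}. t (i + 1 - r))"

definition theta2 :: "nat \<Rightarrow> (int \<Rightarrow> real) \<Rightarrow> int \<Rightarrow> real" where
  "theta2 m t i =
     2 / (real m * (real m - 1)) *
       (\<Sum>s\<in>{1..int m}. \<Sum>r\<in>{1..<s}. t (i + 1 - r) * t (i + 1 - s))"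

definition mu2 :: "nat \<Rightarrow> (int \<Rightarrow> real) \<Rightarrow> int \<Rightarrow> real" where
  "mu2 m t i =
     2 / (real m * (real m + 1)) *
       (\<Sum>s\<in>{1..int m}. \<Sum>r\<in>{1..s}. t (i + 1 - r) * t (i + 1 - s))"

definition is_coeffs :: "nat \<Rightarrow> (int \<Rightarrow> real) \<Rightarrow> int \<Rightarrow> real \<times> real \<times> real \<Rightarrow> bool" where
  "is_coeffs m t i = (\<lambda>(a, b, c).
     a + b + c = 1 \<and>
     theta m t (i - 1) * a + theta m t i * b + theta m t (i + 1) * c = theta m t i \<and>
     mu2 m t (i - 1) * a + mu2 m t i * b + mu2 m t (i + 1) * c = theta2 m t i)"

definition coeffs :: "nat \<Rightarrow> (int \<Rightarrow> real) \<Rightarrow> int \<Rightarrow> real \<times> real \<times> real" where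
  "coeffs m t i = (THE p. is_coeffs m t i p)"

definition G2 :: "nat \<Rightarrow> nat \<Rightarrow> (int \<Rightarrow> real) \<Rightarrow> (real \<Rightarrow> real) \<Rightarrow> real \<Rightarrow> real" where
  "G2 m n t f x =
     f (t 0) * B m n t 0 x
   + (\<Sum>i\<in>{1..int n + int m - 2}.
        (case coeffs m t i of (a, b, c) \<Rightarrow>
           a * lam m n t (i - 1) f + b * lam m n t i f + c * lam m n t (i + 1) f)
        * B m n t i x)
   + f (t (int n)) * B m n t (int n + int m - 1) x"

text \<open>
  The norms take values in the extended reals, so that an upper bound by a real number includes
  the finiteness of the supremum.
\<close>

definition sup_norm :: "real \<Rightarrow> real \<Rightarrow> (real \<Rightarrow> real) \<Rightarrow> ereal" where
  "sup_norm a b f = (SUP x\<in>{a..b}. ereal \<bar>f x\<bar>)"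

definition op_norm :: "real \<Rightarrow> real \<Rightarrow> ((real \<Rightarrow> real) \<Rightarrow> (real \<Rightarrow> real)) \<Rightarrow> ereal" where
  "op_norm a b T = (SUP f\<in>{f. continuous_on {a..b} f \<and> sup_norm a b f \<le> 1}. sup_norm a b (T f))"

end

theory Submission
  imports Defs
begin

text \<open>
  The B-splines are nonnegative and sum to 1, and the functionals \<open>\<lambda>\<^sub>i\<close> are averages, so the norm of
  the operator is at most the maximum of 1 and of all \<open>\<bar>a\<^sub>i\<bar> + \<bar>b\<^sub>i\<bar> + \<bar>c\<^sub>i\<bar>\<close>.

  The linear system is solved explicitly. Let \<open>L = t\<^sub>i - t\<^bsub>i-m+1\<^esub>\<close>, \<open>A = t\<^sub>i - t\<^bsub>i-m\<^esub>\<close>,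
  \<open>C = t\<^bsub>i+1\<^esub> - t\<^bsub>i-m+1\<^esub>\<close>, \<open>D = t\<^bsub>i+1\<^esub> - t\<^bsub>i-m\<^esub>\<close>, and let \<open>V\<close> be the sum of \<open>(t\<^sub>r - t\<^sub>s)\<^sup>2\<close> over all
  pairs of the \<open>m\<close> knots \<open>t\<^bsub>i-m+1\<^esub>, \<dots>, t\<^sub>i\<close>. When the second moments are expressed by power sums
  of the knots, the system telescopes and gives
  \<open>a\<^sub>i = - V / ((m - 1) A D)\<close> and \<open>c\<^sub>i = - V / ((m - 1) C D)\<close>. Both are nonpositive, hence
  \<open>\<bar>a\<^sub>i\<bar> + \<bar>b\<^sub>i\<bar> + \<bar>c\<^sub>i\<bar> = 1 + 2 (\<bar>a\<^sub>i\<bar> + \<bar>c\<^sub>i\<bar>)\<close>.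

  Among \<open>m\<close> points in an interval of length \<open>L\<close>, the value of \<open>V\<close> is largest when half of them sit at
  each end, so \<open>V \<le> \<lfloor>m\<^sup>2/4\<rfloor> L\<^sup>2\<close> (lemma \<open>knot_spread_le\<close>). Since \<open>L\<close> is at most each of \<open>A\<close>, \<open>C\<close>, \<open>D\<close>,
  both \<open>\<bar>a\<^sub>i\<bar>\<close> and \<open>\<bar>c\<^sub>i\<bar>\<close> are at most \<open>\<lfloor>m\<^sup>2/4\<rfloor> / (m - 1) \<le> (k + 1) / 2\<close> where \<open>k = \<lfloor>m/2\<rfloor>\<close>, and the
  bound \<open>1 + 2 (k + 1)\<close> follows.
\<close>

section \<open>Knots\<close>

lemma knot_sequence_mono:
  assumes "knot_sequence m n a b t"
  shows "mono_on {- int m..int n + int m} t"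
proof (rule mono_onI)
  fix r s :: int
  assume rs: "r \<in> {- int m..int n + int m}" "s \<in> {- int m..int n + int m}" "r \<le> s"
  have next_le: "t i \<le> t (i + 1)" if "- int m \<le> i" "i < int n + int m" for i
  proof -
    consider "i < 0" | "0 \<le> i" "i < int n" | "int n \<le> i"
      by linarith
    then show ?thesis
    proof cases
      case 1
      then have "i \<in> {- int m..0}" "i + 1 \<in> {- int m..0}" using that by auto
      then show ?thesis using assms unfolding knot_sequence_def by (metis order_refl)
    next
      case 2
      then have "i \<in> {0..<int n}" by simp
      then show ?thesis using assms unfolding knot_sequence_def by (metis less_imp_le)
    next
      case 3
      then have "i \<in> {int n..int n + int m}" "i + 1 \<in> {int n..int n + int m}" using that by auto
      then show ?thesis using assms unfolding knot_sequence_def by (metis order_refl)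
    qed
  qed
  have "s \<le> int n + int m \<longrightarrow> t r \<le> t s"
    using \<open>r \<le> s\<close>
  proof (induction s rule: int_ge_induct)
    case (step i)
    then show ?case using next_le[of i] rs(1) by auto
  qed simp
  then show "t r \<le> t s" using rs by simp
qed

lemma knot_sequence_left:
  assumes "knot_sequence m n a b t" "- int m \<le> i" "i \<le> 0"
  shows "t i = a"
  using assms unfolding knot_sequence_def by simp

lemma knot_sequence_right:
  assumes "knot_sequence m n a b t" "int n \<le> i" "i \<le> int n + int m"
  shows "t i = b"
  using assms unfolding knot_sequence_def by simp

lemma knot_sequence_less:
  assumes ks: "knot_sequence m n a b t"
    and "- int m \<le> r" "r < int n" "0 < s" "s \<le> int n + int m" "r < s"
  shows "t r < t s"
proof -
  \<comment> \<open>the increasing knots have indices \<open>0..n\<close>, so a strict step is found at \<open>max r 0\<close>\<close>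
  define p where "p = max r 0"
  have p: "0 \<le> p" "p < int n" "r \<le> p" "p + 1 \<le> s"
    using assms ks unfolding p_def knot_sequence_def by auto
  note mono = mono_onD[OF knot_sequence_mono[OF ks]]
  have "t r \<le> t p" using p assms by (intro mono) auto
  also have "t p < t (p + 1)" using ks p unfolding knot_sequence_def by simp
  also have "t (p + 1) \<le> t s" using p assms by (intro mono) auto
  finally show ?thesis .
qed

section \<open>B-splines\<close>

text \<open>
  Nonnegativity and the support are proved together: the weights in the recursion are nonnegative
  only on the support. The strict inequality says that B-splines whose knots all coincide vanish.
\<close>

lemma bspline_nonneg_support:
  assumes "mono_on {j..j + int d + 1} t"
  shows "0 \<le> bspline t e d j x \<and>
    (bspline t e d j x \<noteq> 0 \<longrightarrow> t j \<le> x \<and> x \<le> t (j + int d + 1) \<and> t j < t (j + int d + 1))"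
  using assms
proof (induction d arbitrary: j)
  case 0
  then show ?case by auto
next
  case (Suc d)
  have 1: "mono_on {j..j + int d + 1} t" and 2: "mono_on {j + 1..j + 1 + int d + 1} t"
    using Suc.prems by (auto intro: mono_on_subset)
  have le: "t j \<le> t (j + 1)" "t (j + int d + 1) \<le> t (j + int d + 2)"
    using Suc.prems by (auto intro!: mono_onD[OF Suc.prems])
  note IH1 = Suc.IH[OF 1] and IH2 = Suc.IH[OF 2]
  have eq: "j + 1 + int d + 1 = j + int d + 2" "j + int (Suc d) + 1 = j + int d + 2"
    by simp_all
  have n1: "0 \<le> (x - t j) / (t (j + int d + 1) - t j) * bspline t e d j x"
    using IH1 by (cases "bspline t e d j x = 0") auto
  have n2: "0 \<le> (t (j + int d + 2) - x) / (t (j + int d + 2) - t (j + 1)) * bspline t e d (j + 1) x"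
    using IH2 unfolding eq by (cases "bspline t e d (j + 1) x = 0") auto
  have "t j \<le> x \<and> x \<le> t (j + int d + 2) \<and> t j < t (j + int d + 2)"
    if "bspline t e (Suc d) j x \<noteq> 0"
  proof -
    have "bspline t e d j x \<noteq> 0 \<or> bspline t e d (j + 1) x \<noteq> 0"
      using that by auto
    then show ?thesis using IH1 IH2 le unfolding eq by fastforce
  qed
  then show ?case using n1 n2 unfolding eq by simp
qed

lemma bspline_nonneg: "mono_on {j..j + int d + 1} t \<Longrightarrow> 0 \<le> bspline t e d j x"
  using bspline_nonneg_support by blast

lemma bspline_degenerate:
  "mono_on {j..j + int d + 1} t \<Longrightarrow> t j = t (j + int d + 1) \<Longrightarrow> bspline t e d j x = 0"
  using bspline_nonneg_support[of j d t e x] by auto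

lemma bspline_0_partition_of_unity:
  assumes ks: "knot_sequence m n a b t" and x: "a \<le> x" "x \<le> b"
  shows "(\<Sum>j\<in>{0..int n - 1}. bspline t b 0 j x) = 1"
proof -
  have t0: "t 0 = a" and tn: "t (int n) = b" and n: "1 \<le> n"
    using ks unfolding knot_sequence_def by auto
  note mono = mono_onD[OF knot_sequence_mono[OF ks]]
  define P where "P j \<longleftrightarrow> t j \<le> x \<and> x < t (j + 1) \<or> t j < x \<and> x = t (j + 1) \<and> x = b" for j
  have ex: "\<exists>j\<in>{0..int n - 1}. P j"
  proof (cases "x = b")
    case True
    have "t (int n - 1) < t (int n)" using n by (intro knot_sequence_less[OF ks]) auto
    then have "P (int n - 1)" using True tn by (auto simp: P_def)
    then show ?thesis using n by force
  next
    case False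
    define J where "J = {j \<in> {0..int n - 1}. t j \<le> x}"
    have J: "finite J" unfolding J_def by (rule finite_subset[of _ "{0..int n - 1}"]) auto
    have "0 \<in> J" using n t0 x by (auto simp: J_def)
    then have q_in: "Max J \<in> J" using J by (intro Max_in) auto
    define q where "q = Max J"
    have q: "q \<in> J" using q_in by (simp add: q_def)
    have "x < t (q + 1)"
    proof (cases "q = int n - 1")
      case True
      then show ?thesis using False x tn by simp
    next
      case False
      have "q + 1 \<notin> J" using Max_ge[OF J, of "q + 1"] unfolding q_def by linarith
      then show ?thesis using False q by (auto simp: J_def)
    qed
    then have "P q" using q by (auto simp: P_def J_def)
    then show ?thesis using q by (auto simp: J_def)
  qed
  have uniq: "j = l" if "P j" "P l" "j \<in> {0..int n - 1}" "l \<in> {0..int n - 1}" for j l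
  proof -
    have no: "\<not> i < h" if "P i" "P h" "i \<in> {0..int n - 1}" "h \<in> {0..int n - 1}" for i h
    proof
      assume "i < h"
      have "t (i + 1) \<le> t h" using that \<open>i < h\<close> by (intro mono) auto
      moreover have "t (h + 1) \<le> t (int n)" using that by (intro mono) auto
      ultimately show False using that \<open>i < h\<close> tn unfolding P_def by auto
    qed
    show ?thesis using no[of j l] no[of l j] that by (meson linorder_neqE)
  qed
  obtain q where q: "q \<in> {0..int n - 1}" "P q" using ex by blast
  have "(\<Sum>j\<in>{0..int n - 1}. bspline t b 0 j x) = (\<Sum>j\<in>{0..int n - 1}. if j = q then 1 else 0)"
  proof (rule sum.cong)
    fix j assume "j \<in> {0..int n - 1}"
    then have "P j \<longleftrightarrow> j = q" using q uniq by blast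
    then show "bspline t b 0 j x = (if j = q then 1 else 0)" by (simp add: P_def)
  qed simp
  also have "\<dots> = 1" using q by simp
  finally show ?thesis .
qed

text \<open>
  The two weights that the recursion puts on a B-spline of degree \<open>d\<close> add up to 1, so passing from
  degree \<open>d\<close> to \<open>d + 1\<close> preserves the sum up to the B-splines with indices \<open>-d - 1\<close> and \<open>n\<close>. These
  vanish, since all their knots coincide with an endpoint of the interval.
\<close>

lemma bspline_partition_of_unity:
  assumes ks: "knot_sequence m n a b t" and x: "a \<le> x" "x \<le> b" and "d \<le> m"
  shows "(\<Sum>j\<in>{- int d..int n - 1}. bspline t b d j x) = 1"
  using \<open>d \<le> m\<close>
proof (induction d)
  case 0
  then show ?case using bspline_0_partition_of_unity[OF ks x] by simp
next
  case (Suc d)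
  have n: "1 \<le> n" using ks unfolding knot_sequence_def by simp
  have mono: "mono_on {j..j + int d + 1} t" if "- int m \<le> j" "j \<le> int n" for j
    using knot_sequence_mono[OF ks] that Suc.prems by (auto intro: mono_on_subset)
  define w where "w j = (x - t j) / (t (j + int d + 1) - t j)" for j
  define v where "v j = (t (j + int d + 1) - x) / (t (j + int d + 1) - t j)" for j
  define N where "N j = bspline t b d j x" for j
  have wv: "w j * N j + v j * N j = N j" if "- int m \<le> j" "j \<le> int n" for j
  proof (cases "t j = t (j + int d + 1)")
    case True
    then show ?thesis using bspline_degenerate[OF mono[OF that]] by (simp add: N_def)
  next
    case False
    then have "w j + v j = 1" unfolding w_def v_def add_divide_distrib[symmetric] by simp
    then show ?thesis by (metis distrib_right mult_1)
  qed
  have N_left: "N (- int d - 1) = 0"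
    using Suc.prems knot_sequence_left[OF ks] unfolding N_def
    by (intro bspline_degenerate mono) auto
  have N_right: "N (int n) = 0"
    using Suc.prems knot_sequence_right[OF ks] unfolding N_def
    by (intro bspline_degenerate mono) auto
  have split_left: "{- int (Suc d)..int n - 1} = insert (- int d - 1) {- int d..int n - 1}"
    by auto
  have split_right: "{- int d..int n} = insert (int n) {- int d..int n - 1}"
    using n by auto
  have "bspline t b (Suc d) j x = w j * N j + v (j + 1) * N (j + 1)" for j
    unfolding w_def v_def N_def by (simp add: algebra_simps)
  then have "(\<Sum>j\<in>{- int (Suc d)..int n - 1}. bspline t b (Suc d) j x)
      = (\<Sum>j\<in>{- int (Suc d)..int n - 1}. w j * N j)
      + (\<Sum>j\<in>{- int (Suc d)..int n - 1}. v (j + 1) * N (j + 1))"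
    by (simp only: sum.distrib)
  also have "(\<Sum>j\<in>{- int (Suc d)..int n - 1}. w j * N j) = (\<Sum>j\<in>{- int d..int n - 1}. w j * N j)"
    unfolding split_left using N_left by simp
  also have "(\<Sum>j\<in>{- int (Suc d)..int n - 1}. v (j + 1) * N (j + 1)) = (\<Sum>j\<in>{- int d..int n}. v j * N j)"
    by (rule sum.reindex_bij_witness[where i="\<lambda>j. j - 1" and j="\<lambda>j. j + 1"]) auto
  also have "\<dots> = (\<Sum>j\<in>{- int d..int n - 1}. v j * N j)"
    unfolding split_right using N_right by simp
  also have "(\<Sum>j\<in>{- int d..int n - 1}. w j * N j) + \<dots> = (\<Sum>j\<in>{- int d..int n - 1}. N j)"
    unfolding sum.distrib[symmetric] using Suc.prems by (intro sum.cong wv) auto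
  also have "\<dots> = 1" using Suc unfolding N_def by simp
  finally show ?case .
qed

section \<open>The averaging functionals\<close>

text \<open>
  No integrability is needed here: the integral of a function that is not integrable is 0, and so
  is a quotient by 0.
\<close>

lemma abs_integral_normalized_le_1:
  fixes g f :: "real \<Rightarrow> real"
  assumes g: "\<And>x. 0 \<le> g x" and f: "\<And>x. x \<in> {a..b} \<Longrightarrow> \<bar>f x\<bar> \<le> 1"
  shows "\<bar>integral {a..b} (\<lambda>x. g x / integral {a..b} g * f x)\<bar> \<le> 1"
proof (cases "integral {a..b} g = 0 \<or>
    \<not> (\<lambda>x. g x / integral {a..b} g * f x) integrable_on {a..b}")
  case True
  then have "integral {a..b} (\<lambda>x. g x / integral {a..b} g * f x) = 0"
    by (elim disjE) (simp, rule not_integrable_integral)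
  then show ?thesis by (simp only: abs_zero zero_le_one)
next
  case False
  define c where "c = integral {a..b} g"
  have int_g: "g integrable_on {a..b}" using False not_integrable_integral by blast
  have c: "0 < c" using False integral_nonneg[OF int_g] g unfolding c_def by force
  have "norm (integral {a..b} (\<lambda>x. g x / c * f x)) \<le> integral {a..b} (\<lambda>x. g x / c)"
  proof (rule integral_norm_bound_integral)
    show "(\<lambda>x. g x / c * f x) integrable_on {a..b}" using False by (simp add: c_def)
    show "(\<lambda>x. g x / c) integrable_on {a..b}" using int_g by (rule integrable_on_divide)
    show "norm (g x / c * f x) \<le> g x / c" if "x \<in> {a..b}" for x
      using mult_left_mono[OF f[OF that], of "g x / c"] g[of x] c by (simp add: abs_mult)
  qed
  also have "\<dots> = 1" using c by (simp add: c_def)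
  finally show ?thesis by (simp add: c_def)
qed

lemma abs_lam_le_1:
  assumes ks: "knot_sequence m n a b t" and m: "2 \<le> m"
    and f: "\<And>x. x \<in> {a..b} \<Longrightarrow> \<bar>f x\<bar> \<le> 1"
    and i: "0 \<le> i" "i \<le> int n + int m - 1"
  shows "\<bar>lam m n t i f\<bar> \<le> 1"
proof -
  have t0: "t 0 = a" and tn: "t (int n) = b"
    using ks unfolding knot_sequence_def by auto
  have "a \<le> b"
    using mono_onD[OF knot_sequence_mono[OF ks], of 0 "int n"] t0 tn by simp
  have "mono_on {i - int m + 1..i - int m + 1 + int (m - 2) + 1} t"
    using knot_sequence_mono[OF ks] by (rule mono_on_subset) (use i m in auto)
  then have "0 \<le> bspline t b (m - 2) (i - int m + 1) x" for x
    by (rule bspline_nonneg)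
  then have "\<bar>integral {a..b} (\<lambda>x. M m n t i x * f x)\<bar> \<le> 1"
    unfolding M_def t0 tn by (intro abs_integral_normalized_le_1 f)
  then show ?thesis using f \<open>a \<le> b\<close> by (auto simp: lam_def t0 tn)
qed

section \<open>Power sums of consecutive knots\<close>

text \<open>The sum of the \<open>p\<close>-th powers of the \<open>m\<close> knots \<open>t\<^bsub>i-m+1\<^esub>, \<dots>, t\<^sub>i\<close>.\<close>

definition power_sum :: "(int \<Rightarrow> real) \<Rightarrow> nat \<Rightarrow> nat \<Rightarrow> int \<Rightarrow> real" where
  "power_sum t p m i = (\<Sum>r\<in>{1..int m}. t (i + 1 - r) ^ p)"

lemma atLeastAtMost_int_Suc: "{1..int (Suc m)} = insert (int m + 1) {1..int m}"
  by auto

lemma power_sum_0 [simp]: "power_sum t p 0 i = 0"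
  by (simp add: power_sum_def)

lemma power_sum_Suc: "power_sum t p (Suc m) i = power_sum t p m i + t (i - int m) ^ p"
  unfolding power_sum_def atLeastAtMost_int_Suc by simp

lemma power_sum_shift:
  "power_sum t p m (i + 1) = power_sum t p m i + t (i + 1) ^ p - t (i + 1 - int m) ^ p"
  by (induction m) (simp_all add: power_sum_Suc algebra_simps)

lemma power_sum_Suc_Suc:
  "power_sum t p (Suc (Suc m)) i = t i ^ p + power_sum t p m (i - 1) + t (i - int m - 1) ^ p"
  using power_sum_shift[of t p "m" "i - 1"] by (simp add: power_sum_Suc algebra_simps)

lemma sum_strict_pairs:
  fixes u :: "int \<Rightarrow> real"
  shows "(\<Sum>s\<in>{1..int m}. \<Sum>r\<in>{1..<s}. u r * u s)
    = ((\<Sum>r\<in>{1..int m}. u r)\<^sup>2 - (\<Sum>r\<in>{1..int m}. (u r)\<^sup>2)) / 2"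
proof (induction m)
  case (Suc m)
  have "{1..<int m + 1} = {1..int m}" by auto
  then show ?case unfolding atLeastAtMost_int_Suc using Suc
    by (simp add: sum_distrib_right[symmetric] power2_eq_square field_simps)
qed simp

lemma sum_weak_pairs:
  fixes u :: "int \<Rightarrow> real"
  shows "(\<Sum>s\<in>{1..int m}. \<Sum>r\<in>{1..s}. u r * u s)
    = ((\<Sum>r\<in>{1..int m}. u r)\<^sup>2 + (\<Sum>r\<in>{1..int m}. (u r)\<^sup>2)) / 2"
proof (induction m)
  case (Suc m)
  have "{1..int m + 1} = insert (int m + 1) {1..int m}" by auto
  then show ?case unfolding atLeastAtMost_int_Suc using Suc
    by (simp add: sum_distrib_right[symmetric] power2_eq_square field_simps)
qed simp

lemma theta_power_sum: "theta m t i = power_sum t 1 m i / real m"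
  by (simp add: theta_def power_sum_def)

lemma mult_halves: "2 / x * (y / 2) = y / x" for x y :: real
  by simp

lemma theta2_power_sum:
  "theta2 m t i = ((power_sum t 1 m i)\<^sup>2 - power_sum t 2 m i) / (real m * (real m - 1))"
  unfolding theta2_def power_sum_def sum_strict_pairs mult_halves by simp

lemma mu2_power_sum:
  "mu2 m t i = ((power_sum t 1 m i)\<^sup>2 + power_sum t 2 m i) / (real m * (real m + 1))"
  unfolding mu2_def power_sum_def sum_weak_pairs mult_halves by simp

text \<open>
  By Lagrange's identity this is the sum of the squared differences over all pairs of the knots
  \<open>t\<^bsub>i-m+1\<^esub>, \<dots>, t\<^sub>i\<close>, that is, \<open>m\<^sup>2\<close> times their variance.
\<close>

definition knot_spread :: "(int \<Rightarrow> real) \<Rightarrow> nat \<Rightarrow> int \<Rightarrow> real" where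
  "knot_spread t m i = real m * power_sum t 2 m i - (power_sum t 1 m i)\<^sup>2"

lemma knot_spread_nonneg: "0 \<le> knot_spread t m i"
proof -
  have "(\<Sum>r\<in>{1..int m}. t (i + 1 - r) * 1)\<^sup>2
      \<le> (\<Sum>r\<in>{1..int m}. (t (i + 1 - r))\<^sup>2) * (\<Sum>r\<in>{1..int m}. 1\<^sup>2)"
    by (rule Cauchy_Schwarz_ineq_sum)
  then show ?thesis by (simp add: knot_spread_def power_sum_def mult.commute)
qed

text \<open>
  Induction in steps of two, removing the two extreme knots \<open>p \<le> q\<close>: a knot \<open>y\<close> between them
  contributes \<open>(y - p)\<^sup>2 + (q - y)\<^sup>2 \<le> (q - p)\<^sup>2\<close> to the pairs that are lost, and the extreme pair
  contributes \<open>(q - p)\<^sup>2\<close>.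
\<close>

lemma knot_spread_le:
  assumes "mono_on {i - int m + 1..i} t"
  shows "knot_spread t m i \<le> real (m\<^sup>2 div 4) * (t i - t (i - int m + 1))\<^sup>2"
  using assms
proof (induction m arbitrary: i rule: nat_induct2)
  case 0
  then show ?case by (simp add: knot_spread_def)
next
  case 1
  then show ?case by (simp add: knot_spread_def power_sum_Suc)
next
  case (step m)
  define p q where "p = t (i - int m - 1)" and "q = t i"
  have mono: "t r \<le> t s" if "i - int m - 1 \<le> r" "r \<le> s" "s \<le> i" for r s
    using that by (intro mono_onD[OF step.prems]) auto
  have pq: "p \<le> q" unfolding p_def q_def by (intro mono) auto
  have y: "2 * (t (i - r))\<^sup>2 - 2 * (p + q) * t (i - r) + (p\<^sup>2 + q\<^sup>2) \<le> (q - p)\<^sup>2"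
    if "r \<in> {1..int m}" for r
  proof -
    have "p \<le> t (i - r)" "t (i - r) \<le> q"
      unfolding p_def q_def using that by (auto intro!: mono)
    then have "0 \<le> (t (i - r) - p) * (q - t (i - r))" by simp
    then show ?thesis by (simp add: power2_eq_square algebra_simps)
  qed
  have "(\<Sum>r\<in>{1..int m}. 2 * (t (i - r))\<^sup>2 - 2 * (p + q) * t (i - r) + (p\<^sup>2 + q\<^sup>2))
      \<le> (\<Sum>r\<in>{1..int m}. (q - p)\<^sup>2)"
    by (rule sum_mono) (rule y)
  then have inner: "2 * power_sum t 2 m (i - 1) - 2 * (p + q) * power_sum t 1 m (i - 1)
      + real m * (p\<^sup>2 + q\<^sup>2) \<le> real m * (q - p)\<^sup>2"
    by (simp add: power_sum_def sum.distrib sum_subtractf sum_distrib_left)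
  have "knot_spread t (m + 2) i = knot_spread t m (i - 1) + (q - p)\<^sup>2
      + (2 * power_sum t 2 m (i - 1) - 2 * (p + q) * power_sum t 1 m (i - 1)
      + real m * (p\<^sup>2 + q\<^sup>2))"
    unfolding knot_spread_def p_def q_def
    by (simp add: power_sum_Suc_Suc) (simp add: power2_eq_square algebra_simps)
  then have 1: "knot_spread t (m + 2) i \<le> knot_spread t m (i - 1) + (real m + 1) * (q - p)\<^sup>2"
    using inner by (simp add: algebra_simps)
  have "mono_on {i - 1 - int m + 1..i - 1} t"
    using step.prems by (rule mono_on_subset) auto
  then have "knot_spread t m (i - 1) \<le> real (m\<^sup>2 div 4) * (t (i - 1) - t (i - 1 - int m + 1))\<^sup>2"
    by (rule step.IH)
  also have "\<dots> \<le> real (m\<^sup>2 div 4) * (q - p)\<^sup>2"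
  proof (cases "m = 0")
    case False
    have "t (i - 1 - int m + 1) \<le> t (i - 1)" "t (i - 1) \<le> q" "p \<le> t (i - 1 - int m + 1)"
      unfolding p_def q_def using False by (auto intro!: mono)
    then show ?thesis by (intro mult_left_mono power_mono) auto
  qed simp
  finally have 2: "knot_spread t m (i - 1) \<le> real (m\<^sup>2 div 4) * (q - p)\<^sup>2" .
  have "(m + 2)\<^sup>2 = m\<^sup>2 + (m + 1) * 4" by (simp add: power2_eq_square)
  then have "(m + 2)\<^sup>2 div 4 = m\<^sup>2 div 4 + (m + 1)" by (metis div_mult_self1 zero_neq_numeral add.commute)
  then have "real ((m + 2)\<^sup>2 div 4) = real (m\<^sup>2 div 4) + (real m + 1)" by simp
  then have "knot_spread t (m + 2) i \<le> real ((m + 2)\<^sup>2 div 4) * (q - p)\<^sup>2"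
    using 1 2 by (simp add: algebra_simps)
  then show ?case by (simp add: p_def q_def algebra_simps)
qed

section \<open>The coefficients of the quasi-interpolant\<close>

text \<open>
  The second equation reads \<open>C * c = A * a\<close>. With this the third one, after subtraction of \<open>\<mu>\<^sub>i\<close> times
  the first, contains only \<open>a\<close>.
\<close>

lemma is_coeffs_iff:
  fixes t :: "int \<Rightarrow> real" and i :: int and m :: nat
  defines "A \<equiv> t i - t (i - int m)" and "C \<equiv> t (i + 1) - t (i + 1 - int m)"
    and "D \<equiv> t (i + 1) - t (i - int m)"
  assumes m: "2 \<le> m" and pos: "0 < A" "0 < C" "0 < D"
  shows "is_coeffs m t i (a, b, c) \<longleftrightarrow>
    a = - knot_spread t m i / ((real m - 1) * A * D) \<and>
    c = - knot_spread t m i / ((real m - 1) * C * D) \<and>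
    b = 1 - a - c"
proof -
  define S Q where "S = power_sum t 1 m i" and "Q = power_sum t 2 m i"
  define V where "V = knot_spread t m i"
  define \<mu> where "\<mu> = mu2 m t i"
  have V: "V = real m * Q - S\<^sup>2" by (simp add: V_def knot_spread_def S_def Q_def)
  have up: "power_sum t 1 m (i + 1) = S + C"
    "power_sum t 2 m (i + 1) = Q + C * (t (i + 1) + t (i + 1 - int m))"
    using power_sum_shift[of t 1 m i] power_sum_shift[of t 2 m i]
    by (simp_all add: S_def Q_def C_def power2_eq_square algebra_simps)
  have down: "power_sum t 1 m (i - 1) = S - A"
    "power_sum t 2 m (i - 1) = Q - A * (t i + t (i - int m))"
    using power_sum_shift[of t 1 m "i - 1"] power_sum_shift[of t 2 m "i - 1"]
    by (simp_all add: S_def Q_def A_def power2_eq_square algebra_simps)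
  have M: "0 < real m" "0 < real m - 1" "0 < real m + 1" using m by auto
  have th: "theta m t (i + 1) = theta m t i + C / real m" "theta m t (i - 1) = theta m t i - A / real m"
    unfolding theta_power_sum up down S_def[symmetric] by (simp_all add: add_divide_distrib diff_divide_distrib)
  have mu_up: "mu2 m t (i + 1) = \<mu> + 2 * C * (S + t (i + 1)) / (real m * (real m + 1))"
    unfolding \<mu>_def mu2_power_sum up S_def[symmetric] Q_def[symmetric] add_divide_distrib[symmetric]
    by (rule arg_cong[where f="\<lambda>z. z / _"]) (simp add: C_def power2_eq_square algebra_simps)
  have mu_down: "mu2 m t (i - 1) = \<mu> - 2 * A * (S + t (i - int m)) / (real m * (real m + 1))"
    unfolding \<mu>_def mu2_power_sum down S_def[symmetric] Q_def[symmetric] diff_divide_distrib[symmetric]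
    by (rule arg_cong[where f="\<lambda>z. z / _"]) (simp add: A_def power2_eq_square algebra_simps)
  have th2: "theta2 m t i = \<mu> - 2 * V / (real m * (real m - 1) * (real m + 1))"
    unfolding \<mu>_def mu2_power_sum theta2_power_sum S_def[symmetric] Q_def[symmetric] V
    using M by (simp add: divide_simps) (simp add: power2_eq_square algebra_simps)
  have eq2: "theta m t (i - 1) * a + theta m t i * b + theta m t (i + 1) * c = theta m t i \<longleftrightarrow> C * c = A * a"
    if "b = 1 - a - c"
  proof -
    have "theta m t (i - 1) * a + theta m t i * b + theta m t (i + 1) * c - theta m t i
        = (C * c - A * a) / real m"
      unfolding th that by (simp add: algebra_simps diff_divide_distrib)
    then show ?thesis using M by auto
  qed
  have eq3: "mu2 m t (i - 1) * a + mu2 m t i * b + mu2 m t (i + 1) * c = theta2 m t i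
      \<longleftrightarrow> a * ((real m - 1) * A * D) = - V" if b: "b = 1 - a - c" and c: "C * c = A * a"
  proof -
    have "mu2 m t (i - 1) * a + mu2 m t i * b + mu2 m t (i + 1) * c - theta2 m t i
        = (2 * (C * c) * (S + t (i + 1)) - 2 * (A * a) * (S + t (i - int m))) / (real m * (real m + 1))
          + 2 * V / (real m * (real m - 1) * (real m + 1))"
      unfolding mu_up mu_down th2 \<mu>_def[symmetric] b
      by (simp add: algebra_simps diff_divide_distrib)
    also have "2 * (C * c) * (S + t (i + 1)) - 2 * (A * a) * (S + t (i - int m)) = 2 * (A * a) * D"
      unfolding c D_def by (simp add: algebra_simps)
    also have "2 * (A * a) * D / (real m * (real m + 1)) + 2 * V / (real m * (real m - 1) * (real m + 1))
        = 2 * (a * ((real m - 1) * A * D) + V) / (real m * (real m - 1) * (real m + 1))"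
      using M by (simp add: divide_simps)
    finally have diff: "mu2 m t (i - 1) * a + mu2 m t i * b + mu2 m t (i + 1) * c - theta2 m t i
        = 2 * (a * ((real m - 1) * A * D) + V) / (real m * (real m - 1) * (real m + 1))" .
    have "2 * y / (real m * (real m - 1) * (real m + 1)) = 0 \<longleftrightarrow> y = 0" for y
      using M by simp
    then have "mu2 m t (i - 1) * a + mu2 m t i * b + mu2 m t (i + 1) * c - theta2 m t i = 0
        \<longleftrightarrow> a * ((real m - 1) * A * D) + V = 0"
      unfolding diff .
    then show ?thesis by (simp only: right_minus_eq eq_neg_iff_add_eq_0)
  qed
  have nz: "(real m - 1) * A * D \<noteq> 0" "(real m - 1) * C * D \<noteq> 0" "C \<noteq> 0" using M pos by auto
  have "is_coeffs m t i (a, b, c) \<longleftrightarrow> b = 1 - a - c \<and> C * c = A * a \<and> a * ((real m - 1) * A * D) = - V"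
  proof -
    have "a + b + c = 1 \<longleftrightarrow> b = 1 - a - c" by auto
    then show ?thesis using eq2 eq3 unfolding is_coeffs_def prod.case by blast
  qed
  also have "\<dots> \<longleftrightarrow> b = 1 - a - c \<and> C * c = A * a \<and> a = - V / ((real m - 1) * A * D)"
    by (simp only: nonzero_eq_divide_eq[OF nz(1)])
  also have "\<dots> \<longleftrightarrow> b = 1 - a - c \<and> c = - V / ((real m - 1) * C * D) \<and> a = - V / ((real m - 1) * A * D)"
  proof -
    have "C * c = A * a \<longleftrightarrow> c = - V / ((real m - 1) * C * D)" if "a = - V / ((real m - 1) * A * D)"
    proof -
      have "A * a = C * (- V / ((real m - 1) * C * D))"
        unfolding that using pos by simp
      then have "C * c = A * a \<longleftrightarrow> C * c = C * (- V / ((real m - 1) * C * D))" by (simp only:)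
      also have "\<dots> \<longleftrightarrow> c = - V / ((real m - 1) * C * D)" by (rule mult_left_cancel[OF nz(3)])
      finally show ?thesis .
    qed
    then show ?thesis by blast
  qed
  finally show ?thesis unfolding V_def by blast
qed

lemma square_div_4_le: "2 * real (m\<^sup>2 div 4) \<le> (real (m div 2) + 1) * (real m - 1)" if "2 \<le> m"
proof -
  obtain k where k: "m = 2 * k \<or> m = 2 * k + 1" by (metis oddE evenE)
  then show ?thesis
  proof
    assume mk: "m = 2 * k"
    then have "m\<^sup>2 div 4 = k\<^sup>2" "1 \<le> real k" using that by (auto simp: power2_eq_square)
    then show ?thesis using mk by (simp add: power2_eq_square algebra_simps)
  next
    assume mk: "m = 2 * k + 1"
    then have "m\<^sup>2 = 1 + (k * (k + 1)) * 4" by (simp add: power2_eq_square algebra_simps)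
    then have "m\<^sup>2 div 4 = k * (k + 1)" by simp
    then show ?thesis using mk by (simp add: algebra_simps)
  qed
qed

lemma coeffs_abs_sum_le:
  assumes ks: "knot_sequence m n a0 b0 t" and m: "2 \<le> m"
    and i: "1 \<le> i" "i \<le> int n + int m - 2" and coeffs: "coeffs m t i = (a, b, c)"
  shows "\<bar>a\<bar> + \<bar>b\<bar> + \<bar>c\<bar> \<le> 2 * real (m div 2) + 3"
proof -
  define A where "A = t i - t (i - int m)"
  define C where "C = t (i + 1) - t (i + 1 - int m)"
  define D where "D = t (i + 1) - t (i - int m)"
  define L where "L = t i - t (i - int m + 1)"
  define V where "V = knot_spread t m i"
  have pos: "0 < A" "0 < C" "0 < D"
    unfolding A_def C_def D_def using i m knot_sequence_less[OF ks] by auto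
  note mono = mono_onD[OF knot_sequence_mono[OF ks]]
  have "t (i - int m) \<le> t (i - int m + 1)" "t (i - int m + 1) \<le> t i" "t i \<le> t (i + 1)"
    using i m by (auto intro!: mono)
  then have L: "0 \<le> L" "L \<le> A" "L \<le> C" "L \<le> D"
    unfolding L_def A_def C_def D_def by (simp_all add: algebra_simps)
  define p where "p = (- V / ((real m - 1) * A * D), 1 + V / ((real m - 1) * A * D)
    + V / ((real m - 1) * C * D), - V / ((real m - 1) * C * D))"
  have iff: "is_coeffs m t i q \<longleftrightarrow> q = p" for q
    using is_coeffs_iff[OF m, where t=t and i=i] pos
    unfolding A_def[symmetric] C_def[symmetric] D_def[symmetric] V_def[symmetric]
    by (cases q) (auto simp: p_def)
  have "coeffs m t i = p" unfolding coeffs_def iff by (rule the_eq_trivial)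
  then have abc: "a = - V / ((real m - 1) * A * D)" "c = - V / ((real m - 1) * C * D)" "b = 1 - a - c"
    using coeffs by (simp_all add: p_def)
  have M: "0 < real m - 1" using m by simp
  have "mono_on {i - int m + 1..i} t"
    using knot_sequence_mono[OF ks] by (rule mono_on_subset) (use i in auto)
  then have "V \<le> real (m\<^sup>2 div 4) * L\<^sup>2"
    unfolding V_def L_def by (rule knot_spread_le)
  then have "2 * V \<le> 2 * real (m\<^sup>2 div 4) * L\<^sup>2" by simp
  also have "\<dots> \<le> (real (m div 2) + 1) * (real m - 1) * L\<^sup>2"
    using square_div_4_le[OF m] by (intro mult_right_mono) auto
  finally have V: "2 * V \<le> (real (m div 2) + 1) * (real m - 1) * L\<^sup>2" .
  have V0: "0 \<le> V" unfolding V_def by (rule knot_spread_nonneg)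
  have bound: "V / ((real m - 1) * E * D) \<le> (real (m div 2) + 1) / 2" if "0 < E" "L \<le> E" for E
  proof -
    have "L\<^sup>2 \<le> E * D" unfolding power2_eq_square using that L by (intro mult_mono) auto
    then have "(real (m div 2) + 1) * (real m - 1) * L\<^sup>2 \<le> (real (m div 2) + 1) * (real m - 1) * (E * D)"
      using M by (intro mult_left_mono) auto
    then have "2 * V \<le> (real (m div 2) + 1) * ((real m - 1) * E * D)"
      using V by (simp only: mult.assoc)
    then show ?thesis using M that pos by (simp add: pos_divide_le_eq)
  qed
  have "a \<le> 0" "c \<le> 0" unfolding abc using V0 M pos by (auto simp: divide_nonneg_pos)
  moreover have "- a \<le> (real (m div 2) + 1) / 2" "- c \<le> (real (m div 2) + 1) / 2"
    unfolding abc using bound[of A] bound[of C] pos L by auto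
  ultimately show ?thesis using abc(3) by (simp add: abs_if)
qed

section \<open>The norm of the quasi-interpolant\<close>

lemma abs_G2_le:
  assumes ks: "knot_sequence m n a b t" and m: "2 \<le> m"
    and f: "\<And>x. x \<in> {a..b} \<Longrightarrow> \<bar>f x\<bar> \<le> 1" and x: "a \<le> x" "x \<le> b"
  shows "\<bar>G2 m n t f x\<bar> \<le> 2 * real (m div 2) + 3"
proof -
  have t0: "t 0 = a" and tn: "t (int n) = b" and n: "1 \<le> n"
    using ks unfolding knot_sequence_def by auto
  define K where "K = 2 * real (m div 2) + 3"
  define N where "N j = B m n t j x" for j
  define I where "I = {1..int n + int m - 2}"
  define g where "g i = (case coeffs m t i of (a, b, c) \<Rightarrow>
    a * lam m n t (i - 1) f + b * lam m n t i f + c * lam m n t (i + 1) f)" for i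
  have N0: "0 \<le> N j" if "0 \<le> j" "j \<le> int n + int m - 1" for j
    unfolding N_def B_def
    by (intro bspline_nonneg mono_on_subset[OF knot_sequence_mono[OF ks]]) (use that in auto)
  have g: "\<bar>g i\<bar> \<le> K" if "i \<in> I" for i
  proof -
    obtain p q r where pqr: "coeffs m t i = (p, q, r)" by (metis prod_cases3)
    have le: "\<bar>y * lam m n t j f\<bar> \<le> \<bar>y\<bar>" if "0 \<le> j" "j \<le> int n + int m - 1" for y j
      using abs_lam_le_1[OF ks m f that] by (simp add: abs_mult mult_left_le)
    have "\<bar>g i\<bar> \<le> \<bar>p * lam m n t (i - 1) f\<bar> + \<bar>q * lam m n t i f\<bar> + \<bar>r * lam m n t (i + 1) f\<bar>"
      unfolding g_def pqr prod.case by (intro order_trans[OF abs_triangle_ineq] add_right_mono abs_triangle_ineq)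
    also have "\<dots> \<le> \<bar>p\<bar> + \<bar>q\<bar> + \<bar>r\<bar>"
      by (intro add_mono; rule le) (use \<open>i \<in> I\<close> in \<open>auto simp: I_def\<close>)
    also have "\<dots> \<le> K"
      using coeffs_abs_sum_le[OF ks m _ _ pqr] \<open>i \<in> I\<close> by (simp add: K_def I_def)
    finally show ?thesis .
  qed
  have split: "{0..int n + int m - 1} = insert 0 (insert (int n + int m - 1) I)"
    using n m by (auto simp: I_def)
  have "(\<Sum>j\<in>{0..int n + int m - 1}. N j) = (\<Sum>j\<in>{- int m..int n - 1}. bspline t b m j x)"
    unfolding N_def B_def tn
    by (rule sum.reindex_bij_witness[where i="\<lambda>j. j + int m" and j="\<lambda>j. j - int m"]) auto
  also have "\<dots> = 1" by (rule bspline_partition_of_unity[OF ks x]) simp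
  finally have one: "N 0 + (\<Sum>j\<in>I. N j) + N (int n + int m - 1) = 1"
    unfolding split using n m by (simp add: I_def)
  have end_le: "\<bar>f y * N j\<bar> \<le> K * N j" if "y \<in> {a..b}" "0 \<le> j" "j \<le> int n + int m - 1" for y j
    unfolding abs_mult using f[OF that(1)] N0[OF that(2,3)] by (auto intro!: mult_mono simp: K_def)
  have "\<bar>\<Sum>i\<in>I. g i * N i\<bar> \<le> (\<Sum>i\<in>I. \<bar>g i * N i\<bar>)" by (rule sum_abs)
  also have "\<dots> \<le> (\<Sum>i\<in>I. K * N i)"
    using g N0 by (intro sum_mono) (auto simp: abs_mult I_def intro!: mult_right_mono)
  also have "\<dots> = K * (\<Sum>i\<in>I. N i)" by (simp add: sum_distrib_left)
  finally have mid: "\<bar>\<Sum>i\<in>I. g i * N i\<bar> \<le> K * (\<Sum>i\<in>I. N i)" .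
  have "\<bar>f a * N 0\<bar> \<le> K * N 0"
    using x n by (intro end_le) auto
  moreover have "\<bar>f b * N (int n + int m - 1)\<bar> \<le> K * N (int n + int m - 1)"
    using x n by (intro end_le) auto
  ultimately have "\<bar>f a * N 0 + (\<Sum>i\<in>I. g i * N i) + f b * N (int n + int m - 1)\<bar>
      \<le> K * (N 0 + (\<Sum>j\<in>I. N j) + N (int n + int m - 1))"
    using mid unfolding distrib_left by linarith
  then show ?thesis
    unfolding one unfolding G2_def t0 tn g_def N_def I_def K_def by simp
qed

lemma op_norm_G2_le:
  assumes "knot_sequence m n a b t" "2 \<le> m"
  shows "op_norm a b (G2 m n t) \<le> ereal (2 * real (m div 2) + 3)"
  unfolding op_norm_def
proof (rule SUP_least)
  fix f assume "f \<in> {f. continuous_on {a..b} f \<and> sup_norm a b f \<le> 1}"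
  then have f: "\<bar>f x\<bar> \<le> 1" if "x \<in> {a..b}" for x
    using that by (auto simp: sup_norm_def SUP_le_iff)
  show "sup_norm a b (G2 m n t f) \<le> ereal (2 * real (m div 2) + 3)"
    unfolding sup_norm_def
    by (rule SUP_least) (use abs_G2_le[OF assms f] in simp)
qed

theorem theorem6:
  fixes m :: nat
  assumes "2 \<le> m"
  shows "(\<exists>C::real. \<forall>(n::nat) (a::real) (b::real) (t::int \<Rightarrow> real).
            knot_sequence m n a b t \<longrightarrow> op_norm a b (G2 m n t) \<le> ereal C) \<and>
         (\<forall>(k::nat) (n::nat) (a::real) (b::real) (t::int \<Rightarrow> real).
            (m = 2 * k \<or> m = 2 * k + 1) \<longrightarrow> knot_sequence m n a b t \<longrightarrow>
            op_norm a b (G2 m n t) \<le> ereal (2 * real k + 3))"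
proof (intro conjI exI allI impI)
  fix n a b t
  assume ks: "knot_sequence m n a b t"
  then show "op_norm a b (G2 m n t) \<le> ereal (2 * real (m div 2) + 3)"
    using assms by (rule op_norm_G2_le)
next
  fix k n a b t
  assume "m = 2 * k \<or> m = 2 * k + 1" and ks: "knot_sequence m n a b t"
  then have "m div 2 = k" by auto
  then show "op_norm a b (G2 m n t) \<le> ereal (2 * real k + 3)"
    using op_norm_G2_le[OF ks assms] by simp
qed

end
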